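(* Let $F$ be R. Thompson's group and consider its generating set $\{x_0,x_1,x_2\}$. The Cheeger isoperimetric constant of the Cayley graph of $F$ with respect to $\{x_0,x_1,x_2\}$ is strictly less than $1$, that is, $\iota_*(F;\{x_0,x_1,x_2\})<1$. Equivalently, the density of the corresponding Cayley graph strictly exceeds $5$, that is, $\delta(F;\{x_0,x_1,x_2\})>5$.
   Context: R. Thompson's group $F$ is the group given by the presentation $\langle x_0,x_1,x_2,\ldots \mid x_jx_i=x_ix_{j+1}\ (0\le i<j)\rangle$. Since $x_n=x_0^{-(n-1)}x_1x_0^{n-1}$ for $n\ge 2$, it is generated by $x_0,x_1$, hence also by $x_0,x_1,x_2$, where $x_2=x_0^{-1}x_1x_0$. Let $G$ be a group generated by a finite set $A$ with $|A|=m$. The (right) Cayley graph of $G$ with respect to $A$ has vertex set $G$ and, for every $g\in G$ and every one of the $2m$ symbols $a\in A^{\pm1}$, a directed edge labelled $a$ from $g$ to $ga$; its inverse edge is the edge labelled $a^{-1}$ from $ga$ to $g$. (One may equally use the left Cayley graph, in which the edge labelled $a$ starting at $g$ goes to $a^{-1}g$; the quantities below are the same.) A finite nonempty subset $Y\subseteq G$ is identified with the subgraph of the Cayley graph it induces (all edges connecting vertices of $Y$). The density $\delta(Y)$ is the average vertex degree of this subgraph, i.e. $\delta(Y)=\frac{1}{|Y|}\,\#\{(g,a): g\in Y,\ a\in A^{\pm1},\ ga\in Y\}$. The Cheeger boundary $\partial_*Y$ is the set of directed edges from a vertex of $Y$ to a vertex outside $Y$, i.e. $\{(g,a): g\in Y,\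 a\in A^{\pm1},\ ga\notin Y\}$, and $\iota_*(Y)=|\partial_*Y|/|Y|$; one has $\delta(Y)+\iota_*(Y)=2m$. The density of the Cayley graph is $\delta(G;A)=\sup_Y\delta(Y)$ and the Cheeger isoperimetric constant is $\iota_*(G;A)=\inf_Y\iota_*(Y)$, where $Y$ ranges over all finite nonempty subsets of $G$. *)

theory Defs
  imports Complex_Main "HOL-Algebra.Generated_Groups" "Graph_Theory.Digraph_Component"
begin

section \<open>Groups given by presentations\<close>

text \<open>
  A word over the generators is a list of letters; \<open>(a, True)\<close> stands for the generator
  \<open>a\<close> and \<open>(a, False)\<close> for its formal inverse.
\<close>

type_synonym 'a word = "('a \<times> bool) list"

text \<open>
  The least congruence on words that contains the pairs of \<open>R\<close> (read as defining equations
  \<open>u = v\<close>) and cancels adjacent mutually inverse letters.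
\<close>

inductive word_eq :: "('a word \<times> 'a word) set \<Rightarrow> 'a word \<Rightarrow> 'a word \<Rightarrow> bool"
  for R :: "('a word \<times> 'a word) set" where
  refl: "word_eq R u u"
| sym: "word_eq R u v \<Longrightarrow> word_eq R v u"
| trans: "word_eq R u v \<Longrightarrow> word_eq R v w \<Longrightarrow> word_eq R u w"
| app: "word_eq R u u' \<Longrightarrow> word_eq R v v' \<Longrightarrow> word_eq R (u @ v) (u' @ v')"
| cancel: "word_eq R [(a, b), (a, \<not> b)] []"
| rel: "(u, v) \<in> R \<Longrightarrow> word_eq R u v"

definition word_class :: "('a word \<times> 'a word) set \<Rightarrow> 'a word \<Rightarrow> 'a word set" where
  "word_class R u = {v. word_eq R u v}"

text \<open>The group presented by all elements of the type \<open>'a\<close> as generators and the relations \<open>R\<close>.\<close>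

definition presented_group :: "('a word \<times> 'a word) set \<Rightarrow> 'a word set monoid" where
  "presented_group R =
     \<lparr>carrier = UNIV // {(u, v). word_eq R u v},
      monoid.mult = (\<lambda>X Y. \<Union>u\<in>X. \<Union>v\<in>Y. word_class R (u @ v)),
      monoid.one = word_class R []\<rparr>"

lemma word_class_eq_iff: "word_class R u = word_class R v \<longleftrightarrow> word_eq R u v"
proof
  assume "word_class R u = word_class R v"
  then have "v \<in> word_class R u" by (simp add: word_class_def word_eq.refl)
  then show "word_eq R u v" by (simp add: word_class_def)
next
  assume "word_eq R u v"
  then show "word_class R u = word_class R v"
    unfolding word_class_def by (blast intro: word_eq.sym word_eq.trans)
qed

lemma carrier_presented_group: "carrier (presented_group R) = range (word_class R)"
  by (auto simp: presented_group_def quotient_def word_class_def)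

lemma one_presented_group: "\<one>\<^bsub>presented_group R\<^esub> = word_class R []"
  by (simp add: presented_group_def)

lemma mult_presented_group:
  "word_class R u \<otimes>\<^bsub>presented_group R\<^esub> word_class R v = word_class R (u @ v)"
proof -
  have "word_class R (u' @ v') = word_class R (u @ v)"
    if "u' \<in> word_class R u" "v' \<in> word_class R v" for u' v'
    using that unfolding word_class_eq_iff
    by (intro word_eq.sym[OF word_eq.app]) (simp_all add: word_class_def)
  moreover have "u \<in> word_class R u" "v \<in> word_class R v"
    by (simp_all add: word_class_def word_eq.refl)
  ultimately have "(\<Union>u'\<in>word_class R u. \<Union>v'\<in>word_class R v. word_class R (u' @ v'))
      = word_class R (u @ v)"
    by blast
  then show ?thesis by (simp add: presented_group_def)
qed

definition word_inv :: "'a word \<Rightarrow> 'a word" where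
  "word_inv u = rev (map (\<lambda>(a, b). (a, \<not> b)) u)"

lemma word_inv_left: "word_eq R (word_inv u @ u) []"
proof (induction u)
  case Nil
  show ?case by (simp add: word_inv_def word_eq.refl)
next
  case (Cons x u)
  obtain a b where x: "x = (a, b)" by (cases x)
  have "word_eq R ([(a, \<not> b), (a, b)] @ u) ([] @ u)"
    using word_eq.cancel[of R a "\<not> b"] by (intro word_eq.app word_eq.refl) simp
  then have "word_eq R (word_inv u @ [(a, \<not> b), (a, b)] @ u) (word_inv u @ [] @ u)"
    by (intro word_eq.app[OF word_eq.refl])
  from word_eq.trans[OF this] show ?case using Cons by (simp add: word_inv_def x)
qed

lemma group_presented_group: "group (presented_group R)"
proof (rule groupI)
  fix x assume "x \<in> carrier (presented_group R)"
  then obtain u where "x = word_class R u" by (auto simp: carrier_presented_group)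
  then have "word_class R (word_inv u) \<otimes>\<^bsub>presented_group R\<^esub> x = \<one>\<^bsub>presented_group R\<^esub>"
    by (simp add: mult_presented_group one_presented_group word_class_eq_iff word_inv_left)
  then show "\<exists>y\<in>carrier (presented_group R). y \<otimes>\<^bsub>presented_group R\<^esub> x = \<one>\<^bsub>presented_group R\<^esub>"
    by (auto simp: carrier_presented_group)
qed (auto simp: carrier_presented_group mult_presented_group one_presented_group)


section \<open>Thompson's group F\<close>

definition thompson_rels :: "(nat word \<times> nat word) set" where
  "thompson_rels =
     {([(j, True), (i, True)], [(i, True), (Suc j, True)]) | i j. i < j}"

definition thompson_F :: "nat word set monoid" where
  "thompson_F = presented_group thompson_rels"

definition thompson_x :: "nat \<Rightarrow> nat word set" where
  "thompson_x n = word_class thompson_rels [(n, True)]"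

interpretation thompson_F: group thompson_F
  unfolding thompson_F_def by (rule group_presented_group)

lemma thompson_x_closed: "thompson_x n \<in> carrier thompson_F"
  by (simp add: thompson_F_def thompson_x_def carrier_presented_group)

lemma thompson_x_rel:
  assumes "i < j"
  shows "thompson_x j \<otimes>\<^bsub>thompson_F\<^esub> thompson_x i = thompson_x i \<otimes>\<^bsub>thompson_F\<^esub> thompson_x (Suc j)"
  unfolding thompson_F_def thompson_x_def mult_presented_group word_class_eq_iff
  using assms by (intro word_eq.rel) (auto simp: thompson_rels_def)

lemma inv_word_class_letter:
  "inv\<^bsub>presented_group R\<^esub> (word_class R [(a, True)]) = word_class R [(a, False)]"
proof (rule group.inv_equality[OF group_presented_group])
  show "word_class R [(a, False)] \<otimes>\<^bsub>presented_group R\<^esub> word_class R [(a, True)]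
      = \<one>\<^bsub>presented_group R\<^esub>"
    using word_eq.cancel[of R a False]
    by (simp add: mult_presented_group one_presented_group word_class_eq_iff)
qed (auto simp: carrier_presented_group)

lemma thompson_F_generated:
  "generate thompson_F {thompson_x 0, thompson_x 1, thompson_x 2} = carrier thompson_F"
    (is "generate _ ?A = _")
proof
  have A: "?A \<subseteq> carrier thompson_F" by (auto simp: thompson_x_closed)
  show "generate thompson_F ?A \<subseteq> carrier thompson_F"
    by (rule thompson_F.generate_incl[OF A])
  have sub: "subgroup (generate thompson_F ?A) thompson_F"
    by (rule thompson_F.generate_is_subgroup[OF A])
  have x: "thompson_x n \<in> generate thompson_F ?A" for n
  proof (induction n rule: less_induct)
    case (less n)
    show ?case
    proof (cases "n \<le> 2")
      case True
      then have "n = 0 \<or> n = 1 \<or> n = 2" by linarith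
      then show ?thesis by (auto intro: generate.incl)
    next
      case False
      then obtain k where k: "n = Suc k" "0 < k" by (cases n) auto
      have "thompson_x n =
          inv\<^bsub>thompson_F\<^esub> (thompson_x 0) \<otimes>\<^bsub>thompson_F\<^esub> (thompson_x k \<otimes>\<^bsub>thompson_F\<^esub> thompson_x 0)"
        using thompson_x_rel[OF k(2)] k(1)
        by (subst thompson_F.inv_solve_left) (simp_all add: thompson_x_closed)
      moreover have "thompson_x k \<in> generate thompson_F ?A" using less k by simp
      ultimately show ?thesis
        by (simp add: generate.eng generate.inv generate.incl)
    qed
  qed
  have "word_class thompson_rels u \<in> generate thompson_F ?A" for u
  proof (induction u)
    case Nil
    show ?case
      using generate.one[of thompson_F] by (simp add: thompson_F_def one_presented_group)
  next
    case (Cons l u)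
    obtain n b where l: "l = (n, b)" by (cases l)
    have "word_class thompson_rels [l] \<in> generate thompson_F ?A"
    proof (cases b)
      case True
      then show ?thesis using x[of n] by (simp add: l thompson_x_def)
    next
      case False
      then show ?thesis
        using subgroup.m_inv_closed[OF sub x[of n]]
        by (simp add: l thompson_x_def thompson_F_def inv_word_class_letter)
    qed
    from generate.eng[OF this Cons.IH] show ?case
      by (simp add: thompson_F_def mult_presented_group)
  qed
  then show "carrier thompson_F \<subseteq> generate thompson_F ?A"
    by (auto simp: thompson_F_def carrier_presented_group)
qed


section \<open>Cayley graphs, density and the Cheeger constant\<close>

text \<open>
  The edge labels are the \<open>2 * card A\<close> formal symbols \<open>(a, True)\<close> and \<open>(a, False)\<close>, standing
  for \<open>a\<close> and its inverse, so the two labels stay distinct even if \<open>a\<close> is an involution.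
\<close>

definition label_val :: "('g, 'm) monoid_scheme \<Rightarrow> 'g \<times> bool \<Rightarrow> 'g" where
  "label_val G = (\<lambda>(a, b). if b then a else inv\<^bsub>G\<^esub> a)"

definition cayley_graph ::
    "('g, 'm) monoid_scheme \<Rightarrow> 'g set \<Rightarrow> ('g, 'g \<times> ('g \<times> bool)) pre_digraph" where
  "cayley_graph G A =
     \<lparr>verts = carrier G,
      arcs = carrier G \<times> (A \<times> UNIV),
      tail = fst,
      head = (\<lambda>(g, s). g \<otimes>\<^bsub>G\<^esub> label_val G s)\<rparr>"

text \<open>
  Every geometric edge is a pair of mutually inverse directed edges, hence the degree of a vertex
  is its out-degree.
\<close>

definition density_of :: "('g, 'm) monoid_scheme \<Rightarrow> 'g set \<Rightarrow> 'g set \<Rightarrow> real" where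
  "density_of G A Y =
     (\<Sum>v\<in>Y. real (out_degree (cayley_graph G A \<restriction> Y) v)) / real (card Y)"

definition cheeger_boundary ::
    "('g, 'm) monoid_scheme \<Rightarrow> 'g set \<Rightarrow> 'g set \<Rightarrow> ('g \<times> ('g \<times> bool)) set" where
  "cheeger_boundary G A Y =
     {e \<in> arcs (cayley_graph G A).
        tail (cayley_graph G A) e \<in> Y \<and> head (cayley_graph G A) e \<notin> Y}"

definition cheeger_of :: "('g, 'm) monoid_scheme \<Rightarrow> 'g set \<Rightarrow> 'g set \<Rightarrow> real" where
  "cheeger_of G A Y = real (card (cheeger_boundary G A Y)) / real (card Y)"

definition fin_subsets :: "('g, 'm) monoid_scheme \<Rightarrow> 'g set set" where
  "fin_subsets G = {Y. finite Y \<and> Y \<noteq> {} \<and> Y \<subseteq> carrier G}"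

definition cayley_density :: "('g, 'm) monoid_scheme \<Rightarrow> 'g set \<Rightarrow> real" where
  "cayley_density G A = (SUP Y \<in> fin_subsets G. density_of G A Y)"

definition cheeger_const :: "('g, 'm) monoid_scheme \<Rightarrow> 'g set \<Rightarrow> real" where
  "cheeger_const G A = (INF Y \<in> fin_subsets G. cheeger_of G A Y)"

lemma density_of_eq_card:
  assumes "finite A" "Y \<in> fin_subsets G"
  shows "density_of G A Y =
    real (card {(g, s). g \<in> Y \<and> s \<in> A \<times> UNIV \<and> g \<otimes>\<^bsub>G\<^esub> label_val G s \<in> Y}) / real (card Y)"
proof -
  let ?E = "\<lambda>v. {s \<in> A \<times> UNIV. v \<otimes>\<^bsub>G\<^esub> label_val G s \<in> Y}"
  have Y: "finite Y" "Y \<subseteq> carrier G" using assms by (auto simp: fin_subsets_def)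
  have "out_degree (cayley_graph G A \<restriction> Y) v = card (?E v)" if "v \<in> Y" for v
  proof -
    have "out_arcs (cayley_graph G A \<restriction> Y) v = Pair v ` ?E v"
      using that Y by (auto simp: out_arcs_def induce_subgraph_def cayley_graph_def)
    then show ?thesis by (simp add: out_degree_def card_image inj_on_def)
  qed
  then have "(\<Sum>v\<in>Y. out_degree (cayley_graph G A \<restriction> Y) v) = card (Sigma Y ?E)"
    using Y assms(1) by (subst card_SigmaI) auto
  moreover have "Sigma Y ?E =
      {(g, s). g \<in> Y \<and> s \<in> A \<times> UNIV \<and> g \<otimes>\<^bsub>G\<^esub> label_val G s \<in> Y}"
    by auto
  ultimately show ?thesis by (simp add: density_of_def flip: of_nat_sum)
qed

lemma density_plus_cheeger:
  assumes "finite A" "Y \<in> fin_subsets G"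
  shows "density_of G A Y + cheeger_of G A Y = 2 * real (card A)"
proof -
  let ?I = "{(g, s). g \<in> Y \<and> s \<in> A \<times> (UNIV :: bool set) \<and> g \<otimes>\<^bsub>G\<^esub> label_val G s \<in> Y}"
  have Y: "finite Y" "Y \<noteq> {}" "Y \<subseteq> carrier G" using assms by (auto simp: fin_subsets_def)
  have un: "?I \<union> cheeger_boundary G A Y = Y \<times> (A \<times> UNIV)"
    using Y by (auto simp: cheeger_boundary_def cayley_graph_def)
  have "finite (?I \<union> cheeger_boundary G A Y)"
    unfolding un using Y assms(1) by simp
  then have fin: "finite ?I" "finite (cheeger_boundary G A Y)"
    by (rule finite_subset[rotated], blast)+
  have "?I \<inter> cheeger_boundary G A Y = {}"
    by (auto simp: cheeger_boundary_def cayley_graph_def)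
  then have "card ?I + card (cheeger_boundary G A Y) = card (Y \<times> (A \<times> (UNIV :: bool set)))"
    using card_Un_disjoint[OF fin] unfolding un by linarith
  then have "real (card ?I) + real (card (cheeger_boundary G A Y)) =
      real (card Y) * (2 * real (card A))"
    unfolding of_nat_add[symmetric] by (simp add: card_cartesian_product)
  moreover have "card Y > 0" using Y by (simp add: card_gt_0_iff)
  ultimately show ?thesis
    unfolding density_of_eq_card[OF assms] cheeger_of_def by (simp add: field_simps)
qed

text \<open>The supremum and the infimum above are taken over nonempty bounded sets of reals.\<close>

lemma cheeger_of_nonneg: "cheeger_of G A Y \<ge> 0"
  by (simp add: cheeger_of_def)

lemma bdd_below_cheeger: "bdd_below (cheeger_of G A ` fin_subsets G)"
  using cheeger_of_nonneg by (intro bdd_belowI2) blast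

lemma bdd_above_density:
  assumes "finite A"
  shows "bdd_above (density_of G A ` fin_subsets G)"
proof (rule bdd_aboveI2)
  fix Y assume "Y \<in> fin_subsets G"
  then show "density_of G A Y \<le> 2 * real (card A)"
    using density_plus_cheeger[OF assms, of Y G] cheeger_of_nonneg[of G A Y] by linarith
qed

lemma (in group) fin_subsets_nonempty: "fin_subsets G \<noteq> {}"
proof -
  have "{\<one>} \<in> fin_subsets G" by (simp add: fin_subsets_def)
  then show ?thesis by blast
qed

end

theory Submission
  imports Defs "HOL-Library.Stream"
begin

text \<open>
  As in the construction of Belk and Brown, binary forests with a marked tree are embedded in the
  Cayley graph: moving the mark is multiplication by \<open>x\<^sub>0\<close>, and splitting the marked tree or its
  right neighbour is multiplication by \<open>x\<^sub>1\<close> or \<open>x\<^sub>2\<close>. Let the trees have height at most \<open>k\<close>, with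
  weight \<open>p\<close> to the number of leaves, where \<open>p\<close> makes the total weight of such trees 1. Then the
  trees of a forest are independent, a split is impossible with probability \<open>p\<close>, and \<open>p \<longlonglongrightarrow> 1/4\<close> as
  \<open>k \<longlonglongrightarrow> \<infinity>\<close>; so the density comes close to \<open>2 (1 + 3/4 + 3/4) = 5\<close>, but not beyond.

  To exceed 5, remove the forests marked at one of the first three trees of a pattern of four
  consecutive trees: trivial, of height \<open>k\<close>, trivial, of height \<open>k\<close>. Such a vertex has degree 3,
  since nothing can be joined and exactly one of the trees at the mark can be split. The three
  vertices of a pattern form a path, so they meet only 7 edges, less than \<open>3 \<times> 5/2\<close>, and
  the proportion removed is bounded below independently of \<open>k\<close>. Requiring the tree before the
  pattern to be nontrivial and of height less than \<open>k\<close> keeps the patterns disjoint.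
\<close>

section \<open>Counting edges in a Cayley graph\<close>

text \<open>Right multiplication by \<open>a\<close> is a bijection from the sources of inner
  \<open>a\<close>-edges to the sources of their inverse edges, so counting positive labels
  suffices.\<close>

lemma (in group) density_of_eq_sum_right_mult:
  assumes A: "finite A" "A \<subseteq> carrier G" and Y: "Y \<in> fin_subsets G"
  shows "density_of G A Y = 2 * (\<Sum>a\<in>A. real (card {g \<in> Y. g \<otimes> a \<in> Y})) / real (card Y)"
proof -
  let ?D = "\<lambda>a. {g \<in> Y. g \<otimes> a \<in> Y}" and ?U = "\<lambda>a. {g \<in> Y. g \<otimes> inv a \<in> Y}"
  have finY: "finite Y" and YG: "Y \<subseteq> carrier G" using Y by (auto simp: fin_subsets_def)
  have U: "?U a = (\<lambda>g. g \<otimes> a) ` ?D a" if "a \<in> A" for a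
  proof -
    have a: "a \<in> carrier G" using that A by blast
    have "g \<in> (\<lambda>g. g \<otimes> a) ` ?D a" if "g \<in> ?U a" for g
      using that a YG by (intro image_eqI[of _ _ "g \<otimes> inv a"]) (auto simp: m_assoc subset_iff)
    moreover have "g \<otimes> a \<otimes> inv a = g" if "g \<in> Y" for g
      using that a YG by (auto simp: m_assoc)
    ultimately show ?thesis by auto
  qed
  have cU: "card (?U a) = card (?D a)" if "a \<in> A" for a
    unfolding U[OF that] using that A(2) YG
    by (intro card_image inj_onI) (auto simp: subset_iff)
  let ?f = "\<lambda>s. {g \<in> Y. g \<otimes> label_val G s \<in> Y}"
  have "{(g, s). g \<in> Y \<and> s \<in> A \<times> UNIV \<and> g \<otimes> label_val G s \<in> Y}
      = prod.swap ` (SIGMA s : A \<times> UNIV. ?f s)"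
    by force
  then have "card {(g, s). g \<in> Y \<and> s \<in> A \<times> UNIV \<and> g \<otimes> label_val G s \<in> Y}
      = card (SIGMA s : A \<times> UNIV. ?f s)"
    by (simp add: card_image)
  also have "\<dots> = (\<Sum>s\<in>A \<times> UNIV. card (?f s))"
    using A(1) finY by (intro card_SigmaI) auto
  also have "\<dots> = (\<Sum>a\<in>A. \<Sum>b\<in>UNIV. card (?f (a, b)))"
    by (simp add: sum.cartesian_product)
  also have "\<dots> = (\<Sum>a\<in>A. 2 * card (?D a))"
    using cU by (intro sum.cong) (auto simp: UNIV_bool label_val_def)
  finally show ?thesis
    unfolding density_of_eq_card[OF A(1) Y] by (simp add: sum_distrib_left)
qed

section \<open>Forests as elements of F\<close>

datatype bintree = Lf | Nd bintree bintree

primrec leaves :: "bintree \<Rightarrow> nat" where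
  "leaves Lf = 1"
| "leaves (Nd a b) = leaves a + leaves b"

lemma leaves_pos: "leaves t > 0"
  by (induction t) auto

lemma leaves_neq_0 [simp]: "leaves t \<noteq> 0"
  using leaves_pos[of t] by simp

text \<open>
  The roots are numbered from \<open>i\<close> on. Right multiplication by the inverse of the \<open>i\<close>-th generator
  joins the roots \<open>i\<close> and \<open>i + 1\<close> by a new caret.
\<close>

primrec tree_word :: "nat \<Rightarrow> bintree \<Rightarrow> nat word" where
  "tree_word i Lf = []"
| "tree_word i (Nd a b) = tree_word i a @ tree_word (Suc i) b @ [(i, False)]"

primrec forest_word :: "nat \<Rightarrow> bintree list \<Rightarrow> nat word" where
  "forest_word i [] = []"
| "forest_word i (t # ts) = tree_word i t @ forest_word (Suc i) ts"

abbreviation cls :: "nat word \<Rightarrow> nat word set" where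
  "cls \<equiv> word_class thompson_rels"

lemma cls_closed [simp]: "cls u \<in> carrier thompson_F"
  by (simp add: thompson_F_def carrier_presented_group)

lemma cls_append: "cls (u @ v) = cls u \<otimes>\<^bsub>thompson_F\<^esub> cls v"
  by (simp add: thompson_F_def mult_presented_group)

lemma cls_Nil: "cls [] = \<one>\<^bsub>thompson_F\<^esub>"
  by (simp add: thompson_F_def one_presented_group)

lemma cls_neg_letter: "cls [(i, False)] = inv\<^bsub>thompson_F\<^esub> (thompson_x i)"
  by (simp add: thompson_F_def thompson_x_def inv_word_class_letter)

lemma cls_neg_letters_commute:
  assumes "i < j"
  shows "cls [(i, False)] \<otimes>\<^bsub>thompson_F\<^esub> cls [(j, False)]
       = cls [(Suc j, False)] \<otimes>\<^bsub>thompson_F\<^esub> cls [(i, False)]"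
  using arg_cong[OF thompson_x_rel[OF assms], of "m_inv thompson_F"]
  by (simp add: cls_neg_letter thompson_F.inv_mult_group thompson_x_closed)

lemma commute_append:
  assumes "c \<in> carrier thompson_F"
    and "c \<otimes>\<^bsub>thompson_F\<^esub> cls u = cls u' \<otimes>\<^bsub>thompson_F\<^esub> c"
    and "c \<otimes>\<^bsub>thompson_F\<^esub> cls v = cls v' \<otimes>\<^bsub>thompson_F\<^esub> c"
  shows "c \<otimes>\<^bsub>thompson_F\<^esub> cls (u @ v) = cls (u' @ v') \<otimes>\<^bsub>thompson_F\<^esub> c"
proof -
  have "c \<otimes>\<^bsub>thompson_F\<^esub> cls (u @ v) = (c \<otimes>\<^bsub>thompson_F\<^esub> cls u) \<otimes>\<^bsub>thompson_F\<^esub> cls v"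
    using assms(1) by (simp add: cls_append thompson_F.m_assoc)
  also have "\<dots> = cls u' \<otimes>\<^bsub>thompson_F\<^esub> (c \<otimes>\<^bsub>thompson_F\<^esub> cls v)"
    using assms(1) by (simp add: assms(2) thompson_F.m_assoc)
  also have "\<dots> = cls (u' @ v') \<otimes>\<^bsub>thompson_F\<^esub> c"
    using assms(1) by (simp add: assms(3) cls_append thompson_F.m_assoc)
  finally show ?thesis .
qed

lemma tree_word_commute:
  assumes "i < j"
  shows "cls [(i, False)] \<otimes>\<^bsub>thompson_F\<^esub> cls (tree_word j t)
       = cls (tree_word (Suc j) t) \<otimes>\<^bsub>thompson_F\<^esub> cls [(i, False)]"
  using assms
proof (induction t arbitrary: j)
  case Lf
  then show ?case by (simp add: cls_Nil)
next
  case (Nd a b)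
  then show ?case
    unfolding tree_word.simps
    by (intro commute_append Nd.IH cls_neg_letters_commute) auto
qed

lemma forest_word_commute:
  assumes "i < j"
  shows "cls [(i, False)] \<otimes>\<^bsub>thompson_F\<^esub> cls (forest_word j ts)
       = cls (forest_word (Suc j) ts) \<otimes>\<^bsub>thompson_F\<^esub> cls [(i, False)]"
  using assms
proof (induction ts arbitrary: j)
  case Nil
  then show ?case by (simp add: cls_Nil)
next
  case (Cons t ts)
  then show ?case
    unfolding forest_word.simps by (intro commute_append tree_word_commute Cons.IH) auto
qed

text \<open>The root caret is the last letter of its tree word. Commuting it past the later trees
  raises their indices by one, as the split requires; there it cancels against the
  generator.\<close>

lemma forest_word_split_root:
  "cls (forest_word i (ts @ Nd a b # us)) \<otimes>\<^bsub>thompson_F\<^esub> thompson_x (i + length ts)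
   = cls (forest_word i (ts @ a # b # us))"
proof (induction ts arbitrary: i)
  case Nil
  have "cls (forest_word i (Nd a b # us)) = cls (tree_word i a) \<otimes>\<^bsub>thompson_F\<^esub>
      (cls (tree_word (Suc i) b) \<otimes>\<^bsub>thompson_F\<^esub>
        (cls [(i, False)] \<otimes>\<^bsub>thompson_F\<^esub> cls (forest_word (Suc i) us)))"
    unfolding forest_word.simps tree_word.simps cls_append
    by (simp add: thompson_F.m_assoc)
  also have "\<dots> = cls (forest_word i (a # b # us)) \<otimes>\<^bsub>thompson_F\<^esub> cls [(i, False)]"
    unfolding forest_word_commute[OF lessI] forest_word.simps cls_append
    by (simp add: thompson_F.m_assoc)
  finally show ?case
    by (simp add: cls_neg_letter thompson_F.m_assoc thompson_x_closed)
next
  case (Cons t ts)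
  then show ?case
    using Cons[of "Suc i"] by (simp add: cls_append thompson_F.m_assoc thompson_x_closed)
qed

section \<open>A faithful action separating forests\<close>

text \<open>
  A point \<open>(n, s)\<close> is an end of the \<open>n\<close>-th copy of the infinite binary tree. Splitting at \<open>i\<close>
  replaces the \<open>i\<close>-th copy by the two subtrees below its root.
\<close>

primrec split_at :: "nat \<Rightarrow> nat \<times> bool stream \<Rightarrow> nat \<times> bool stream" where
  "split_at i (n, s) =
     (if n < i then (n, s) else if n = i then (if shd s then Suc i else i, stl s) else (Suc n, s))"

primrec merge_at :: "nat \<Rightarrow> nat \<times> bool stream \<Rightarrow> nat \<times> bool stream" where
  "merge_at i (n, s) =
     (if n < i then (n, s) else if n = i then (i, False ## s)
      else if n = Suc i then (i, True ## s) else (n - 1, s))"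

lemma merge_split: "merge_at i (split_at i z) = z"
  by (cases z; cases "shd (snd z)") (auto intro: stream.expand)

lemma split_merge: "split_at i (merge_at i z) = z"
  by (cases z) auto

lemma split_at_commute: "i < j \<Longrightarrow> split_at i (split_at j z) = split_at (Suc j) (split_at i z)"
  by (cases z) auto

lemma merge_at_commute: "i < j \<Longrightarrow> merge_at j (merge_at i z) = merge_at i (merge_at (Suc j) z)"
  by (metis split_at_commute merge_split split_merge)

definition letter_act :: "nat \<times> bool \<Rightarrow> nat \<times> bool stream \<Rightarrow> nat \<times> bool stream" where
  "letter_act = (\<lambda>(i, b). if b then merge_at i else split_at i)"

primrec act :: "nat word \<Rightarrow> nat \<times> bool stream \<Rightarrow> nat \<times> bool stream" where
  "act [] z = z"
| "act (l # u) z = letter_act l (act u z)"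

lemma act_append: "act (u @ v) z = act u (act v z)"
  by (induction u) auto

lemma act_word_eq: "word_eq thompson_rels u v \<Longrightarrow> act u z = act v z"
proof (induction arbitrary: z rule: word_eq.induct)
  case (cancel a b)
  then show ?case by (cases b) (auto simp: letter_act_def merge_split split_merge)
next
  case (rel u v)
  then show ?case by (auto simp: thompson_rels_def letter_act_def merge_at_commute)
qed (auto simp: act_append)

lemma act_eq_iff: "act u z = act u z' \<longleftrightarrow> z = z'"
proof -
  have "act (word_inv u) (act u z) = z" for z
    using act_word_eq[OF word_inv_left, of u z] by (simp add: act_append)
  then show ?thesis by metis
qed

text \<open>The leaf, numbered from 0 at the left, that the end \<open>s\<close> passes through, and
  the part of \<open>s\<close> below it.\<close>

primrec descend :: "bintree \<Rightarrow> bool stream \<Rightarrow> nat \<times> bool stream" where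
  "descend Lf s = (0, s)"
| "descend (Nd a b) s =
     (if shd s then apfst ((+) (leaves a)) (descend b (stl s)) else descend a (stl s))"

text \<open>Words act from the right: the root caret splits first, then \<open>b\<close> subdivides
  the right half, and finally \<open>a\<close> shifts the leaves of \<open>b\<close> by
  \<open>leaves a - 1\<close>.\<close>

lemma act_tree_word:
  "act (tree_word i t) (n, s) =
     (if n < i then (n, s) else if n = i then apfst ((+) i) (descend t s) else (n + leaves t - 1, s))"
proof (induction t arbitrary: i n s)
  case (Nd a b)
  have "leaves a > 0" "leaves b > 0" by (rule leaves_pos)+
  then show ?case
    by (cases "descend b (stl s)") (auto simp: act_append letter_act_def Nd.IH)
qed auto

text \<open>Only the trivial tree gives 0 on every end. Ends starting with \<open>False\<close>
  determine the left subtree; subtracting its leaf count then determines the right one.\<close>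

lemma descend_inject: "(\<And>s. fst (descend t s) = fst (descend t' s)) \<Longrightarrow> t = t'"
proof (induction t arbitrary: t')
  case Lf
  show ?case
  proof (cases t')
    case (Nd a b)
    have "fst (descend t' (True ## s)) > 0" for s
      using leaves_pos[of a] Nd by simp
    then show ?thesis using Lf[of "True ## _"] by (metis descend.simps(1) fst_conv less_irrefl)
  qed simp
next
  case (Nd a b)
  show ?case
  proof (cases t')
    case Lf
    then have "fst (descend (Nd a b) (True ## s)) = 0" for s
      using Nd.prems[of "True ## s"] by simp
    then show ?thesis by simp
  next
    case t': (Nd a' b')
    have "fst (descend a s) = fst (descend a' s)" for s
      using Nd.prems[of "False ## s"] t' by simp
    then have a: "a = a'" by (rule Nd.IH)
    have "fst (descend b s) = fst (descend b' s)" for s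
      using Nd.prems[of "True ## s"] t' a by simp
    then have "b = b'" by (rule Nd.IH)
    then show ?thesis using a t' by simp
  qed
qed

lemma act_forest_word_less: "n < i \<Longrightarrow> act (forest_word i ts) (n, s) = (n, s)"
  by (induction ts arbitrary: i) (auto simp: act_append act_tree_word)

text \<open>Without the second assumption, trailing trivial trees would not be detected.\<close>

lemma act_forest_word_inject:
  assumes "\<And>z. act (forest_word i ts) z = act (forest_word i ts') z"
    and "sum_list (map leaves ts) = sum_list (map leaves ts')"
  shows "ts = ts'"
  using assms
proof (induction ts arbitrary: i ts')
  case Nil
  then show ?case by (cases ts') auto
next
  case (Cons t ts)
  then obtain u us where ts': "ts' = u # us" by (cases ts') auto
  have "fst (descend t s) = fst (descend u s)" for s
    \<comment> \<open>The later trees fix the \<open>i\<close>-th copy, so there the first tree acts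
      alone.\<close>
    using Cons.prems(1)[of "(i, s)"]
    by (simp add: ts' act_append act_forest_word_less act_tree_word apfst_def prod_eq_iff)
  then have tu: "t = u" by (rule descend_inject)
  have "ts = us"
    using Cons.prems ts' tu by (intro Cons.IH[of "Suc i"]) (auto simp: act_append act_eq_iff)
  then show ?case by (simp add: ts' tu)
qed

lemma cls_forest_word_inject:
  assumes "cls (forest_word i ts) = cls (forest_word i ts')"
    and "sum_list (map leaves ts) = sum_list (map leaves ts')"
  shows "ts = ts'"
  using assms act_forest_word_inject act_word_eq unfolding word_class_eq_iff by metis

lemma inj_thompson_x: "inj thompson_x"
proof (rule injI)
  fix i j assume "thompson_x i = thompson_x j"
  then have "cls [(i, False)] = cls [(j, False)]" by (simp add: cls_neg_letter)
  then have "split_at i z = split_at j z" for z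
    using act_word_eq[of "[(i, False)]" "[(j, False)]" z]
    by (simp add: word_class_eq_iff letter_act_def)
  \<comment> \<open>This end keeps its number when its own copy is split, but a split at a smaller
    index raises it; two points cover both orders of \<open>i\<close> and \<open>j\<close>.\<close>
  from this[of "(i, sconst False)"] this[of "(j, sconst False)"] show "i = j"
    by (auto split: if_splits)
qed

section \<open>Marked forests\<close>

text \<open>
  A marked forest is a pair of lists: the trees to the left of the mark, nearest first, and the
  trees from the marked one on.
\<close>

type_synonym marked_forest = "bintree list \<times> bintree list"

text \<open>Packing the trees left of the mark into root 0 keeps the mark at root 1; splitting root
  0 releases the nearest tree, which moves the mark left.\<close>

primrec left_comb :: "bintree list \<Rightarrow> bintree" where
  "left_comb [] = Lf"
| "left_comb (t # L) = Nd (left_comb L) t"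

lemma left_comb_inject: "left_comb L = left_comb L' \<Longrightarrow> L = L'"
proof (induction L arbitrary: L')
  case Nil
  then show ?case by (cases L') auto
next
  case (Cons t L)
  then show ?case by (cases L') auto
qed

lemma leaves_left_comb: "leaves (left_comb L) = Suc (sum_list (map leaves L))"
  by (induction L) auto

definition elt :: "marked_forest \<Rightarrow> nat word set" where
  "elt z = cls (forest_word 0 (left_comb (fst z) # snd z))"

definition total_leaves :: "marked_forest \<Rightarrow> nat" where
  "total_leaves z = sum_list (map leaves (fst z)) + sum_list (map leaves (snd z))"

lemma elt_inject:
  assumes "elt z = elt z'" "total_leaves z = total_leaves z'"
  shows "z = z'"
  using cls_forest_word_inject[OF assms(1)[unfolded elt_def]] assms(2)
  by (auto simp: total_leaves_def leaves_left_comb prod_eq_iff dest: left_comb_inject)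

inductive move :: "nat \<Rightarrow> marked_forest \<Rightarrow> marked_forest \<Rightarrow> bool" where
  "move 0 (t # L, R) (L, t # R)"
| "move 1 (L, Nd a b # R) (L, a # b # R)"
| "move 2 (L, t # Nd a b # R) (L, t # a # b # R)"

lemma total_leaves_move: "move i z z' \<Longrightarrow> total_leaves z' = total_leaves z"
  by (induction rule: move.induct) (auto simp: total_leaves_def)

lemma elt_move: "move i z z' \<Longrightarrow> elt z \<otimes>\<^bsub>thompson_F\<^esub> thompson_x i = elt z'"
proof (induction rule: move.induct)
  case (1 t L R)
  show ?case
    using forest_word_split_root[of 0 "[]" "left_comb L" t R] by (simp add: elt_def)
next
  case (2 L a b R)
  show ?case
    using forest_word_split_root[of 0 "[left_comb L]" a b R] by (simp add: elt_def)
next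
  case (3 L t a b R)
  show ?case
    using forest_word_split_root[of 0 "[left_comb L, t]" a b R]
    by (simp add: elt_def numeral_2_eq_2)
qed

definition movable :: "marked_forest set \<Rightarrow> nat \<Rightarrow> marked_forest set" where
  "movable Z i = {z \<in> Z. \<exists>z'\<in>Z. move i z z'}"

abbreviation gens :: "nat word set set" where
  "gens \<equiv> {thompson_x 0, thompson_x 1, thompson_x 2}"

lemma gens_eq: "gens = thompson_x ` {..<3}"
  by (auto simp: lessThan_Suc numeral_3_eq_3 numeral_2_eq_2)

lemma density_of_marked_forests:
  assumes Z: "finite Z" "Z \<noteq> {}" and n: "\<And>z. z \<in> Z \<Longrightarrow> total_leaves z = n"
  shows "elt ` Z \<in> fin_subsets thompson_F"
    and "density_of thompson_F gens (elt ` Z) \<ge>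
      2 * (\<Sum>i<3. real (card (movable Z i))) / real (card Z)"
proof -
  show fin: "elt ` Z \<in> fin_subsets thompson_F"
    using Z by (auto simp: fin_subsets_def elt_def)
  have inj: "inj_on elt Z" using n by (metis inj_onI elt_inject)
  let ?D = "\<lambda>a. {g \<in> elt ` Z. g \<otimes>\<^bsub>thompson_F\<^esub> a \<in> elt ` Z}"
  have "card (movable Z i) \<le> card (?D (thompson_x i))" for i
  proof -
    have "card (movable Z i) = card (elt ` movable Z i)"
      by (intro card_image[symmetric] inj_on_subset[OF inj]) (auto simp: movable_def)
    also have "\<dots> \<le> card (?D (thompson_x i))"
      using Z(1) by (intro card_mono) (auto simp: movable_def elt_move)
    finally show ?thesis .
  qed
  then have "(\<Sum>i<3. real (card (movable Z i))) \<le> (\<Sum>i<3. real (card (?D (thompson_x i))))"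
    by (intro sum_mono) simp
  also have "\<dots> = (\<Sum>a\<in>gens. real (card (?D a)))"
    unfolding gens_eq
    by (subst sum.reindex) (auto intro: inj_on_subset[OF inj_thompson_x])
  finally have "2 * (\<Sum>i<3. real (card (movable Z i))) / real (card Z)
      \<le> 2 * (\<Sum>a\<in>gens. real (card (?D a))) / real (card Z)"
    by (intro divide_right_mono) auto
  also have "\<dots> = density_of thompson_F gens (elt ` Z)"
    using fin
    by (subst thompson_F.density_of_eq_sum_right_mult)
       (auto simp: thompson_x_closed card_image[OF inj])
  finally show "density_of thompson_F gens (elt ` Z) \<ge>
      2 * (\<Sum>i<3. real (card (movable Z i))) / real (card Z)" .
qed

lemma card_gens: "card gens = 3"
  unfolding gens_eq by (subst card_image) (auto intro: inj_on_subset[OF inj_thompson_x])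

text \<open>
  Moves preserve the number of leaves, so an average weighted by \<open>p\<close> to the number of leaves can
  exceed 5 only if the plain average over some class with a fixed number of leaves does.
\<close>

lemma exceeds_if_weighted_exceeds:
  assumes Z: "finite Z" and p: "(p::real) > 0"
    and wt: "2 * (\<Sum>i<3. \<Sum>z\<in>movable Z i. p ^ total_leaves z)
      > 5 * (\<Sum>z\<in>Z. p ^ total_leaves z)"
  shows "\<exists>Y \<in> fin_subsets thompson_F. density_of thompson_F gens Y > 5"
proof -
  define C where "C n = {z \<in> Z. total_leaves z = n}" for n
  have finC: "finite (C n)" for n using Z by (simp add: C_def)
  have grp: "(\<Sum>z\<in>S. p ^ total_leaves z)
      = (\<Sum>n\<in>total_leaves ` Z. p ^ n * card {z \<in> S. total_leaves z = n})"
    if "S \<subseteq> Z" for S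
  proof -
    have "finite S" using Z that finite_subset by blast
    then have "(\<Sum>z\<in>S. p ^ total_leaves z) =
        (\<Sum>n\<in>total_leaves ` Z. \<Sum>z\<in>{z \<in> S. total_leaves z = n}. p ^ total_leaves z)"
      using Z that by (intro sum.group[symmetric]) auto
    also have "\<dots> = (\<Sum>n\<in>total_leaves ` Z. p ^ n * card {z \<in> S. total_leaves z = n})"
      by (intro sum.cong) auto
    finally show ?thesis .
  qed
  have mv: "{z \<in> movable Z i. total_leaves z = n} = movable (C n) i" for i n
    using total_leaves_move unfolding movable_def C_def by blast
  have "(\<Sum>n\<in>total_leaves ` Z. p ^ n * (2 * (\<Sum>i<3. real (card (movable (C n) i)))))
      = 2 * (\<Sum>i<3. \<Sum>z\<in>movable Z i. p ^ total_leaves z)"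
  proof -
    have "(\<Sum>i<3. \<Sum>z\<in>movable Z i. p ^ total_leaves z)
      = (\<Sum>i<3. \<Sum>n\<in>total_leaves ` Z. p ^ n * card (movable (C n) i))"
    proof (rule sum.cong[OF HOL.refl])
      fix i
      have "movable Z i \<subseteq> Z" by (auto simp: movable_def)
      from grp[OF this] show "(\<Sum>z\<in>movable Z i. p ^ total_leaves z)
          = (\<Sum>n\<in>total_leaves ` Z. p ^ n * card (movable (C n) i))"
        by (simp only: mv)
    qed
    also have "\<dots> = (\<Sum>n\<in>total_leaves ` Z. p ^ n * (\<Sum>i<3. real (card (movable (C n) i))))"
      by (subst sum.swap) (simp add: sum_distrib_left)
    finally show ?thesis by (simp add: sum_distrib_left mult_ac)
  qed
  moreover have "(\<Sum>n\<in>total_leaves ` Z. p ^ n * (5 * real (card (C n))))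
      = 5 * (\<Sum>z\<in>Z. p ^ total_leaves z)"
    by (simp add: grp C_def sum_distrib_left mult_ac)
  ultimately have "\<not> (\<Sum>n\<in>total_leaves ` Z. p ^ n * (2 * (\<Sum>i<3. real (card (movable (C n) i)))))
      \<le> (\<Sum>n\<in>total_leaves ` Z. p ^ n * (5 * real (card (C n))))"
    using wt by simp
  then obtain n where n: "n \<in> total_leaves ` Z"
      "\<not> p ^ n * (2 * (\<Sum>i<3. real (card (movable (C n) i)))) \<le> p ^ n * (5 * real (card (C n)))"
    by (meson sum_mono)
  have less: "5 * real (card (C n)) < 2 * (\<Sum>i<3. real (card (movable (C n) i)))"
    using n(2) p by simp
  have ne: "C n \<noteq> {}" using n(1) by (auto simp: C_def)
  then have pos: "real (card (C n)) > 0" using finC by (simp add: card_gt_0_iff)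
  have lv: "\<And>z. z \<in> C n \<Longrightarrow> total_leaves z = n" by (simp add: C_def)
  have "5 < 2 * (\<Sum>i<3. real (card (movable (C n) i))) / real (card (C n))"
    using less pos by (simp add: field_simps)
  also have "\<dots> \<le> density_of thompson_F gens (elt ` C n)"
    by (rule density_of_marked_forests(2)[OF finC ne lv])
  finally show ?thesis using density_of_marked_forests(1)[OF finC ne lv] by blast
qed

section \<open>Product weights on lists\<close>

fun starts :: "'a set list \<Rightarrow> 'a list \<Rightarrow> bool" where
  "starts [] xs = True"
| "starts (S # Ss) [] = False"
| "starts (S # Ss) (x # xs) = (x \<in> S \<and> starts Ss xs)"

text \<open>Cylinder events. A range of lengths is allowed because moves change the lengths of the
  two lists.\<close>

definition cyl :: "'a set \<Rightarrow> 'a set list \<Rightarrow> nat set \<Rightarrow> 'a list set" where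
  "cyl T Ss A = {xs \<in> lists T. length xs \<in> A \<and> starts Ss xs}"

text \<open>As \<open>w\<close> has total 1 on \<open>T\<close>, unconstrained entries contribute
  the factor 1; induction peels off the head.\<close>

lemma cyl_singleton:
  assumes "finite T" "sum w T = (1::real)" "\<forall>S\<in>set Ss. S \<subseteq> T" "length Ss \<le> n"
  shows "finite (cyl T Ss {n})"
    and "(\<Sum>xs\<in>cyl T Ss {n}. prod_list (map w xs)) = prod_list (map (sum w) Ss)"
proof -
  have "finite (cyl T Ss {n}) \<and>
    (\<Sum>xs\<in>cyl T Ss {n}. prod_list (map w xs)) = prod_list (map (sum w) Ss)"
    using assms(3,4)
  proof (induction n arbitrary: Ss)
    case 0
    then have "cyl T Ss {0} = {[]}" by (auto simp: cyl_def)
    then show ?case using 0 by simp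
  next
    case (Suc n)
    have step: "finite (cyl T Us {Suc n}) \<and> (\<Sum>xs\<in>cyl T Us {Suc n}. prod_list (map w xs))
        = sum w S * prod_list (map (sum w) Us')"
      if cons: "cyl T Us {Suc n} = (\<lambda>(x, xs). x # xs) ` (S \<times> cyl T Us' {n})"
        and le: "\<forall>S\<in>set Us'. S \<subseteq> T" "length Us' \<le> n" and S: "S \<subseteq> T" for Us Us' S
    proof -
      note IH = Suc.IH[OF le]
      have inj: "inj_on (\<lambda>(x, xs). x # xs) (S \<times> cyl T Us' {n})" by (auto intro: inj_onI)
      have "finite S" using S assms(1) finite_subset by blast
      moreover have "(\<Sum>xs\<in>cyl T Us {Suc n}. prod_list (map w xs))
          = (\<Sum>(x, xs)\<in>S \<times> cyl T Us' {n}. w x * prod_list (map w xs))"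
        unfolding cons by (subst sum.reindex[OF inj]) (simp add: case_prod_unfold)
      ultimately show ?thesis
        using IH unfolding cons by (simp flip: sum.cartesian_product sum_product)
    qed
    show ?case
    proof (cases Ss)
      case Nil
      have "cyl T [] {Suc n} = (\<lambda>(x, xs). x # xs) ` (T \<times> cyl T [] {n})"
        by (auto simp: cyl_def length_Suc_conv image_iff)
      from step[OF this] show ?thesis using Nil assms(2) by simp
    next
      case (Cons S Ss')
      have "cyl T Ss {Suc n} = (\<lambda>(x, xs). x # xs) ` (S \<times> cyl T Ss' {n})"
        using Suc.prems by (auto simp: cyl_def length_Suc_conv image_iff Cons)
      from step[OF this] show ?thesis using Cons Suc.prems by simp
    qed
  qed
  then show "finite (cyl T Ss {n})"
    and "(\<Sum>xs\<in>cyl T Ss {n}. prod_list (map w xs)) = prod_list (map (sum w) Ss)"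
    by auto
qed

lemma cyl_weight:
  assumes "finite T" "sum w T = (1::real)" "\<forall>S\<in>set Ss. S \<subseteq> T"
    and A: "finite A" "\<forall>n\<in>A. length Ss \<le> n"
  shows "finite (cyl T Ss A)"
    and "(\<Sum>xs\<in>cyl T Ss A. prod_list (map w xs)) = real (card A) * prod_list (map (sum w) Ss)"
proof -
  have U: "cyl T Ss A = (\<Union>n\<in>A. cyl T Ss {n})" by (auto simp: cyl_def)
  note c = cyl_singleton[OF assms(1-3)]
  show "finite (cyl T Ss A)" unfolding U using A c(1) by auto
  have "(\<Sum>xs\<in>cyl T Ss A. prod_list (map w xs))
      = (\<Sum>n\<in>A. \<Sum>xs\<in>cyl T Ss {n}. prod_list (map w xs))"
    unfolding U using A c(1) by (intro sum.UNION_disjoint) (auto simp: cyl_def)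
  also have "\<dots> = (\<Sum>n\<in>A. prod_list (map (sum w) Ss))"
    using A by (intro sum.cong c(2)) auto
  finally show "(\<Sum>xs\<in>cyl T Ss A. prod_list (map w xs)) = real (card A) * prod_list (map (sum w) Ss)"
    by simp
qed

lemma prod_list_power_leaves:
  "prod_list (map (\<lambda>t. p ^ leaves t) ts) = (p::real) ^ sum_list (map leaves ts)"
  by (induction ts) (auto simp: power_add)

section \<open>Trees of bounded height\<close>

primrec trees_upto :: "nat \<Rightarrow> bintree set" where
  "trees_upto 0 = {Lf}"
| "trees_upto (Suc k) = insert Lf ((\<lambda>(a, b). Nd a b) ` (trees_upto k \<times> trees_upto k))"

lemma finite_trees_upto: "finite (trees_upto k)"
  by (induction k) auto

lemma Lf_in_trees_upto: "Lf \<in> trees_upto k"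
  by (cases k) auto

lemma trees_upto_mono_Suc: "trees_upto k \<subseteq> trees_upto (Suc k)"
  by (induction k) auto

abbreviation tree_weight :: "real \<Rightarrow> bintree \<Rightarrow> real" where
  "tree_weight p \<equiv> (\<lambda>t. p ^ leaves t)"

lemma weight_trees_upto_Suc:
  "sum (tree_weight p) (trees_upto (Suc k)) = p + (sum (tree_weight p) (trees_upto k))\<^sup>2"
proof -
  let ?P = "trees_upto k \<times> trees_upto k"
  have inj: "inj_on (\<lambda>(a, b). Nd a b) ?P" by (auto intro: inj_onI)
  have "sum (tree_weight p) (trees_upto (Suc k))
      = p + sum (tree_weight p) ((\<lambda>(a, b). Nd a b) ` ?P)"
    by (simp add: finite_trees_upto image_iff)
  also have "sum (tree_weight p) ((\<lambda>(a, b). Nd a b) ` ?P)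
      = (\<Sum>(a, b)\<in>?P. tree_weight p a * tree_weight p b)"
    by (subst sum.reindex[OF inj]) (simp add: case_prod_unfold power_add)
  finally show ?thesis
    by (simp add: power2_eq_square sum_product sum.cartesian_product)
qed

text \<open>The weights iterate \<open>x \<mapsto> p + x^2\<close>. For \<open>p = 1/4\<close> they
  stay below 1/2 or equal it; for \<open>1/4 + \<epsilon>\<close> each step adds at least
  \<open>\<epsilon>\<close>, as \<open>x^2 + 1/4 \<ge> x\<close>. The intermediate value theorem
  gives \<open>p\<close>.\<close>

lemma exists_critical_weight:
  assumes "\<epsilon> > 0"
  shows "\<exists>k p. 1/4 \<le> p \<and> p \<le> 1/4 + \<epsilon> \<and> sum (tree_weight p) (trees_upto k) = 1"
proof -
  let ?f = "\<lambda>k p. sum (tree_weight p) (trees_upto k)"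
  have lo: "0 \<le> ?f k (1/4) \<and> ?f k (1/4) \<le> 1/2" for k
  proof (induction k)
    case (Suc k)
    have "(?f k (1/4))\<^sup>2 \<le> (1/2)\<^sup>2" using Suc by (intro power_mono) auto
    then show ?case unfolding weight_trees_upto_Suc by (simp add: power2_eq_square)
  qed simp
  have hi: "?f k (1/4 + \<epsilon>) \<ge> real k * \<epsilon>" for k
  proof (induction k)
    case 0
    show ?case using assms by simp
  next
    case (Suc k)
    have "0 \<le> (?f k (1/4 + \<epsilon>) - 1/2)\<^sup>2" by simp
    then show ?case using Suc unfolding weight_trees_upto_Suc
      by (simp add: power2_eq_square algebra_simps)
  qed
  obtain k where "1 < real k * \<epsilon>"
    using reals_Archimedean3[OF assms] by blast
  then have "1 \<le> ?f k (1/4 + \<epsilon>)" using hi[of k] by linarith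
  moreover have "?f k (1/4) \<le> 1" using lo[of k] by linarith
  moreover have "continuous_on {1/4..1/4 + \<epsilon>} (?f k)" by (intro continuous_intros)
  ultimately obtain p where "1/4 \<le> p" "p \<le> 1/4 + \<epsilon>" "?f k p = 1"
    using IVT'[of "?f k" "1/4" 1 "1/4 + \<epsilon>"] assms by auto
  then show ?thesis by blast
qed


section \<open>The dense set\<close>

lemma sum_Diff_ge:
  fixes f :: "'a \<Rightarrow> real"
  assumes "finite A" "finite B" "\<And>x. f x \<ge> 0"
  shows "sum f (A - B) \<ge> sum f A - sum f B"
proof -
  have "sum f A \<le> sum f ((A - B) \<union> B)" using assms by (intro sum_mono2) auto
  also have "\<dots> = sum f (A - B) + sum f B" using assms by (intro sum.union_disjoint) auto
  finally show ?thesis by simp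
qed

lemma sum_Un_le:
  fixes f :: "'a \<Rightarrow> real"
  assumes "finite A" "finite B" "\<And>x. f x \<ge> 0"
  shows "sum f (A \<union> B) \<le> sum f A + sum f B"
  using sum_Un[OF assms(1,2), of f] assms(3) by (simp add: sum_nonneg)

lemma exists_dense_set: "\<exists>Y \<in> fin_subsets thompson_F. density_of thompson_F gens Y > 5"
proof -
  \<comment> \<open>This slack gives \<open>4 * p - 1 \<le> 1/4096\<close>, half the lower bound for
    \<open>q\<close> below.\<close>
  obtain k p where p: "1/4 \<le> p" "p \<le> 1/4 + 1/16384"
    and total: "sum (tree_weight p) (trees_upto k) = 1"
    using exists_critical_weight[of "1/16384"] by auto
  have "k \<noteq> 0" using total p by (intro notI) simp
  then obtain j where k: "k = Suc j" by (cases k) auto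
  define T U where "T = trees_upto (Suc j)" and "U = trees_upto j"
  \<comment> \<open>Trees of height exactly \<open>k\<close>, nontrivial trees of smaller height,
    and all trees that can be split.\<close>
  define K C M where "K = T - U" and "C = U - {Lf}" and "M = T - {Lf}"
  define s where "s = sum (tree_weight p) U"
  \<comment> \<open>Beyond 32768 the gain \<open>N^2 / 4096\<close> exceeds the boundary loss
    \<open>8 * N\<close>.\<close>
  define N :: nat where "N = 40000"
  define wt where "wt z = p ^ total_leaves z" for z
  have finT: "finite T" and finU: "finite U" by (simp_all add: T_def U_def finite_trees_upto)
  have LfU: "Lf \<in> U" by (simp add: U_def Lf_in_trees_upto)
  have UT: "U \<subseteq> T" using trees_upto_mono_Suc by (simp add: U_def T_def)
  have M_cases: "\<exists>a b. t = Nd a b \<and> a \<in> U \<and> b \<in> U" if "t \<in> M" for t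
    using that by (auto simp: M_def T_def U_def)
  have sub: "K \<subseteq> T" "C \<subseteq> T" "M \<subseteq> T" "{Lf} \<subseteq> T"
    using UT LfU by (auto simp: K_def C_def M_def)
  have notK: "t \<notin> K" if "t \<in> U" for t using that by (simp add: K_def)
  have KM: "Lf \<notin> K" "Lf \<notin> C" "Lf \<notin> M" "K \<inter> C = {}"
    using LfU by (auto simp: K_def C_def M_def)

  have wT: "sum (tree_weight p) T = 1" using total by (simp add: T_def k)
  have wK: "sum (tree_weight p) K = 1 - s"
    using sum_diff[OF finT UT, of "tree_weight p"] wT by (simp add: K_def s_def)
  have wC: "sum (tree_weight p) C = s - p"
    using sum_diff[OF finU, of "{Lf}" "tree_weight p"] LfU by (simp add: C_def s_def)
  have wM: "sum (tree_weight p) M = 1 - p"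
    using sum_diff[OF finT sub(4), of "tree_weight p"] wT by (simp add: M_def)
  have s2: "p + s\<^sup>2 = 1"
    using weight_trees_upto_Suc[of p j] total by (simp add: s_def U_def k)
  have s0: "s \<ge> 0" using p by (auto simp: s_def intro!: sum_nonneg)
  have s_le: "s \<le> 7/8"
  proof (rule power2_le_imp_le)
    show "s\<^sup>2 \<le> (7/8)\<^sup>2" using s2 p(1) by (simp add: power_divide)
  qed simp
  have s_ge: "s \<ge> 4/5"
  proof (rule power2_le_imp_le)
    show "(4/5)\<^sup>2 \<le> s\<^sup>2" using s2 p(2) by (simp add: power_divide)
  qed (rule s0)
  \<comment> \<open>The weight of a pattern together with the tree of \<open>C\<close> before
    it.\<close>
  define q where "q = (1 - s)\<^sup>2 * p\<^sup>2 * (s - p)"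
  have q: "q \<ge> 1/2048"
  proof -
    have "(1/8)\<^sup>2 * (1/4)\<^sup>2 * (1/2) \<le> q"
      unfolding q_def using s_le s_ge p by (intro mult_mono power_mono) auto
    then show ?thesis by (simp add: power2_eq_square)
  qed

  have wt_nonneg: "wt z \<ge> 0" for z using p by (simp add: wt_def)
  have box: "finite (cyl T Ss A \<times> cyl T Rs B)"
      "sum wt (cyl T Ss A \<times> cyl T Rs B) =
        (real (card A) * prod_list (map (sum (tree_weight p)) Ss)) *
        (real (card B) * prod_list (map (sum (tree_weight p)) Rs))"
    if "\<forall>S\<in>set Ss. S \<subseteq> T" "\<forall>S\<in>set Rs. S \<subseteq> T" "finite A" "finite B"
      "\<forall>n\<in>A. length Ss \<le> n" "\<forall>n\<in>B. length Rs \<le> n" for Ss Rs A B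
  proof -
    note L = cyl_weight[OF finT wT that(1) that(3) that(5)]
    note R = cyl_weight[OF finT wT that(2) that(4) that(6)]
    show "finite (cyl T Ss A \<times> cyl T Rs B)" using L R by blast
    have "sum wt (cyl T Ss A \<times> cyl T Rs B) = (\<Sum>(xs, ys)\<in>cyl T Ss A \<times> cyl T Rs B.
        prod_list (map (tree_weight p) xs) * prod_list (map (tree_weight p) ys))"
      by (intro sum.cong)
         (auto simp: wt_def total_leaves_def power_add prod_list_power_leaves)
    also have "\<dots> = (\<Sum>xs\<in>cyl T Ss A. prod_list (map (tree_weight p) xs)) *
        (\<Sum>ys\<in>cyl T Rs B. prod_list (map (tree_weight p) ys))"
      by (simp add: sum_product sum.cartesian_product)
    finally show "sum wt (cyl T Ss A \<times> cyl T Rs B) =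
        (real (card A) * prod_list (map (sum (tree_weight p)) Ss)) *
        (real (card B) * prod_list (map (sum (tree_weight p)) Rs))"
      unfolding L(2) R(2) .
  qed

  \<comment> \<open>The lower ends accommodate the longest constraint lists. With length in
    \<open>D\<close>, a left list may lose a tree and stay in range \<open>A\<close>, and a right
    list may gain one and stay in range \<open>B\<close>.\<close>
  define A B where "A = {3..<3 + N}" and "B = {4..<4 + N}"
  define D where "D = {4..<3 + N}"
  have card_AB: "card A = N" "card B = N" by (simp_all add: A_def B_def)
  have N1: "real (N - Suc 0) = real N - 1" by (simp add: N_def)
  then have card_D: "real (card D) = real N - 1" by (simp add: D_def)
  note AB = A_def B_def D_def
  define Y where "Y = cyl T [] A \<times> cyl T [] B"
  \<comment> \<open>The mark is on the first, second or third pattern tree, and for \<open>V\<close>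
    on the fourth. Left lists run away from the mark, so \<open>C\<close> comes last.\<close>
  define W1 where "W1 = cyl T [C] A \<times> cyl T [{Lf}, K, {Lf}, K] B"
  define W2 where "W2 = cyl T [{Lf}, C] A \<times> cyl T [K, {Lf}, K] B"
  define W3 where "W3 = cyl T [K, {Lf}, C] A \<times> cyl T [{Lf}, K] B"
  define V where "V = cyl T [{Lf}, K, {Lf}, C] D \<times> cyl T [K] D"
  define Z where "Z = Y - (W1 \<union> W2 \<union> W3)"
  have finY: "finite Y" unfolding Y_def by (rule box(1)) (auto simp: AB)
  have W1: "finite W1" "sum wt W1 = q * (real N)\<^sup>2"
    using box[of "[C]" "[{Lf}, K, {Lf}, K]" A B] sub
    by (auto simp: W1_def AB wK wC q_def power2_eq_square)
  have W2: "finite W2" "sum wt W2 = q * (real N)\<^sup>2"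
    using box[of "[{Lf}, C]" "[K, {Lf}, K]" A B] sub
    by (auto simp: W2_def AB wK wC q_def power2_eq_square)
  have W3: "finite W3" "sum wt W3 = q * (real N)\<^sup>2"
    using box[of "[K, {Lf}, C]" "[{Lf}, K]" A B] sub
    by (auto simp: W3_def AB wK wC q_def power2_eq_square)
  have V: "finite V" "sum wt V \<le> q * (real N)\<^sup>2"
  proof -
    have "sum wt V = q * (real (card D))\<^sup>2"
      using box[of "[{Lf}, K, {Lf}, C]" "[K]" D D] sub
      by (auto simp: V_def D_def wK wC q_def power2_eq_square)
    also have "\<dots> \<le> q * (real N)\<^sup>2"
      using q card_D by (intro mult_left_mono power_mono) (auto simp: N_def)
    finally show "sum wt V \<le> q * (real N)\<^sup>2" .
    show "finite V" unfolding V_def by (rule box(1)) (use sub in \<open>auto simp: D_def\<close>)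
  qed

  have finZ: "finite Z" using finY by (simp add: Z_def)
  have wZ: "sum wt Z = (1 - 3 * q) * (real N)\<^sup>2"
  proof -
    \<comment> \<open>\<open>W1\<close> differs from the others in the tree just left of the mark,
      \<open>W2\<close> from \<open>W3\<close> in the marked tree.\<close>
    have "z \<notin> W2 \<and> z \<notin> W3" if "z \<in> W1" for z
      using that KM
      by (cases z; cases "fst z"; cases "snd z") (auto simp: W1_def W2_def W3_def cyl_def)
    moreover have "z \<notin> W3" if "z \<in> W2" for z
      using that KM by (cases z; cases "snd z") (auto simp: W2_def W3_def cyl_def)
    ultimately have "W1 \<inter> W2 = {}" "(W1 \<union> W2) \<inter> W3 = {}" by blast+
    then have "sum wt (W1 \<union> W2 \<union> W3) = 3 * q * (real N)\<^sup>2"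
      using W1 W2 W3 by (simp add: sum.union_disjoint)
    moreover have "W1 \<union> W2 \<union> W3 \<subseteq> Y" by (auto simp: W1_def W2_def W3_def Y_def cyl_def)
    moreover have "sum wt Y = (real N)\<^sup>2"
      using box(2)[of "[]" "[]" A B] by (simp add: Y_def AB power2_eq_square)
    ultimately show ?thesis
      unfolding Z_def
      using sum_diff[OF finY, of "W1 \<union> W2 \<union> W3" wt] by (simp add: algebra_simps)
  qed

  have lower: "sum wt (movable Z i) \<ge> sum wt X - sum wt X'"
    if "X - X' \<subseteq> movable Z i" "finite X" "finite X'" for i X X'
  proof -
    have "sum wt X - sum wt X' \<le> sum wt (X - X')"
      using that wt_nonneg by (intro sum_Diff_ge) auto
    also have "\<dots> \<le> sum wt (movable Z i)"
      using that(1) finZ wt_nonneg by (intro sum_mono2) (auto simp: movable_def)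
    finally show ?thesis .
  qed

  have m0: "sum wt (movable Z 0) \<ge> (real N - 1)\<^sup>2 - 4 * q * (real N)\<^sup>2"
  proof -
    define X where "X = cyl T [] D \<times> cyl T [] D"
    have X: "finite X" "sum wt X = (real N - 1)\<^sup>2"
      using box[of "[]" "[]" D D] by (auto simp: X_def D_def power2_eq_square N1)
    \<comment> \<open>A left step enters \<open>W1\<close> only from \<open>W2\<close>,
      \<open>W2\<close> only from \<open>W3\<close>, and \<open>W3\<close> only from
      \<open>V\<close>.\<close>
    have "X - (W1 \<union> W2 \<union> W3 \<union> V) \<subseteq> movable Z 0"
    proof
      fix z assume z: "z \<in> X - (W1 \<union> W2 \<union> W3 \<union> V)"
      then obtain t L R where zt: "z = (t # L, R)"
        by (cases z; cases "fst z") (auto simp: X_def cyl_def D_def)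
      have "(L, t # R) \<in> Y" "z \<in> Y"
        using z by (auto simp: zt X_def Y_def cyl_def AB)
      moreover have "(L, t # R) \<notin> W1"
        using z by (cases L; cases R) (auto simp: zt X_def W1_def W2_def cyl_def AB)
      moreover have "(L, t # R) \<notin> W2"
        using z by (auto simp: zt X_def W2_def W3_def cyl_def AB)
      moreover have "(L, t # R) \<notin> W3"
        using z by (auto simp: zt X_def W3_def V_def cyl_def AB)
      ultimately have "(L, t # R) \<in> Z" "z \<in> Z" using z by (auto simp: Z_def)
      then show "z \<in> movable Z 0" unfolding movable_def zt using move.intros(1) by blast
    qed
    from lower[OF this] have
      "sum wt (movable Z 0) \<ge> sum wt X - sum wt (W1 \<union> W2 \<union> W3 \<union> V)"
      using X W1 W2 W3 V by simp
    moreover have "sum wt (W1 \<union> W2 \<union> W3 \<union> V) \<le> sum wt W1 + sum wt W2 + sum wt W3 + sum wt V"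
      using W1 W2 W3 V wt_nonneg
      by (intro order.trans[OF sum_Un_le] add_right_mono) auto
    ultimately show ?thesis using X W1 W2 W3 V by simp
  qed

  text \<open>
    Splitting a tree of \<open>T\<close> leaves two trees of smaller height next to the mark, which is
    incompatible with the patterns defining \<open>W1\<close>, \<open>W2\<close> and \<open>W3\<close>.
  \<close>

  have m1: "sum wt (movable Z 1) \<ge> (1 - p) * real N * (real N - 1) - q * (real N)\<^sup>2"
  proof -
    define X where "X = cyl T [] A \<times> cyl T [M] D"
    have X: "finite X" "sum wt X = (1 - p) * real N * (real N - 1)"
      using box[of "[]" "[M]" A D] sub
      by (auto simp: X_def AB wM N1)
    \<comment> \<open>In \<open>W1\<close> and \<open>W3\<close> the marked tree is trivial, so
      these sets do not meet \<open>X\<close>.\<close>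
    have "X - W2 \<subseteq> movable Z 1"
    proof
      fix z assume z: "z \<in> X - W2"
      then obtain L t R where zt: "z = (L, t # R)" and "t \<in> M"
        by (cases z; cases "snd z") (auto simp: X_def cyl_def)
      with M_cases obtain a b where ab: "t = Nd a b" "a \<in> U" "b \<in> U" by blast
      have "a \<notin> K" "b \<notin> K" "a \<in> T" "b \<in> T" using notK ab UT by auto
      then have "(L, a # b # R) \<in> Z" "z \<in> Z"
        using z ab by (auto simp: zt X_def Y_def Z_def W1_def W2_def W3_def cyl_def AB)
      then show "z \<in> movable Z 1" unfolding movable_def zt ab using move.intros(2) by blast
    qed
    from lower[OF this] show ?thesis using X W2 by simp
  qed

  have m2: "sum wt (movable Z 2) \<ge> (1 - p) * real N * (real N - 1) - 2 * q * (real N)\<^sup>2"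
  proof -
    define X where "X = cyl T [] A \<times> cyl T [T, M] D"
    have X: "finite X" "sum wt X = (1 - p) * real N * (real N - 1)"
      using box[of "[]" "[T, M]" A D] sub
      by (auto simp: X_def AB wM wT N1)
    \<comment> \<open>In \<open>W2\<close> the right neighbour is trivial, so \<open>W2\<close> does
      not meet \<open>X\<close>.\<close>
    have "X - (W1 \<union> W3) \<subseteq> movable Z 2"
    proof
      fix z assume z: "z \<in> X - (W1 \<union> W3)"
      then obtain L u t R where zt: "z = (L, u # t # R)" and "t \<in> M"
        by (cases z; cases "snd z"; cases "tl (snd z)") (auto simp: X_def cyl_def)
      with M_cases obtain a b where ab: "t = Nd a b" "a \<in> U" "b \<in> U" by blast
      have "a \<notin> K" "b \<notin> K" "a \<in> T" "b \<in> T" using notK ab UT by auto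
      then have "(L, u # a # b # R) \<in> Z" "z \<in> Z"
        using z ab by (auto simp: zt X_def Y_def Z_def W1_def W2_def W3_def cyl_def AB)
      then show "z \<in> movable Z 2" unfolding movable_def zt ab using move.intros(3) by blast
    qed
    from lower[OF this] have "sum wt (movable Z 2) \<ge> sum wt X - sum wt (W1 \<union> W3)"
      using X W1 W3 by simp
    moreover have "sum wt (W1 \<union> W3) \<le> sum wt W1 + sum wt W3"
      using W1 W3 wt_nonneg by (intro sum_Un_le) auto
    ultimately show ?thesis using X W1 W3 by simp
  qed

  \<comment> \<open>Removal changes the balance by \<open>15 * q - 14 * q = q\<close>, which
    outweighs the deficit \<open>4 * p - 1\<close>.\<close>
  have "2 * ((real N - 1)\<^sup>2 + 2 * ((1 - p) * real N * (real N - 1)) - 7 * q * (real N)\<^sup>2)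
      - 5 * ((1 - 3 * q) * (real N)\<^sup>2)
      = (1 - 4 * p + q) * (real N)\<^sup>2 - (4 + 4 * (1 - p)) * real N + 2"
    by (simp add: power2_eq_square algebra_simps)
  moreover have "(1 - 4 * p + q) * (real N)\<^sup>2 \<ge> 1/4096 * (real N)\<^sup>2"
    using p q by (intro mult_right_mono) auto
  moreover have "(4 + 4 * (1 - p)) * real N \<le> 8 * real N"
    using p by (intro mult_right_mono) auto
  moreover have "1/4096 * (real N)\<^sup>2 > 8 * real N" by (simp add: N_def)
  moreover have "(\<Sum>i<3. sum wt (movable Z i))
      = sum wt (movable Z 0) + sum wt (movable Z 1) + sum wt (movable Z 2)"
    by (simp add: numeral_3_eq_3 numeral_2_eq_2)
  ultimately have "2 * (\<Sum>i<3. sum wt (movable Z i)) > 5 * sum wt Z"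
    using m0 m1 m2 wZ by (simp add: algebra_simps)
  then show ?thesis
    using exceeds_if_weighted_exceeds[OF finZ, of p] p by (simp add: wt_def)
qed

theorem theorem2:
  shows "cheeger_const thompson_F {thompson_x 0, thompson_x 1, thompson_x 2} < 1 \<and>
         cayley_density thompson_F {thompson_x 0, thompson_x 1, thompson_x 2} > 5"
proof -
  obtain Y where Y: "Y \<in> fin_subsets thompson_F" "density_of thompson_F gens Y > 5"
    using exists_dense_set by blast
  have fin: "finite gens" by simp
  have "cheeger_of thompson_F gens Y < 1"
    using density_plus_cheeger[OF fin Y(1)] Y(2) unfolding card_gens by simp
  then have "cheeger_const thompson_F gens < 1"
    unfolding cheeger_const_def
    using cINF_lower[OF bdd_below_cheeger Y(1)] by (rule le_less_trans[rotated])
  moreover have "cayley_density thompson_F gens > 5"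
    unfolding cayley_density_def
    using Y(2) cSUP_upper[OF Y(1) bdd_above_density[OF fin]] by (rule less_le_trans)
  ultimately show ?thesis by blast
qed

end
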